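(* Let $n$ and $k$ be integers with $2\le k< n/2$, and let $GP(n,k)$ denote the generalized Petersen graph. (i) If $k\ge 6$ and $k$ is even, then $GP(n,k)$ is not $2$-distance-balanced for any $n>\frac{5}{4}k^2+2k$. (ii) If $k\ge 5$ and $k$ is odd, then $GP(n,k)$ is not $2$-distance-balanced for any $n>\frac{7}{4}k^2+\frac{3}{4}k$. (iii) If $k=2$ and $n>10$, or $k=3$ and $n>10$, or $k=4$ and $n>21$, then $GP(n,k)$ is not $2$-distance-balanced. In addition, $GP(10,2)$, $GP(10,3)$, and $GP(21,4)$ are $2$-distance-balanced.
   Context: For a connected graph $G$ and $x,y\in V(G)$, $d_G(x,y)$ is the length of a shortest $x,y$-path, and $W_{xy}=\{w\in V(G): d_G(w,x)<d_G(w,y)\}$. A connected graph $G$ of diameter at least $\ell$ is $\ell$-distance-balanced if $|W_{xy}|=|W_{yx}|$ for all $x,y\in V(G)$ with $d_G(x,y)=\ell$. For $n\ge 3$ and $1\le k<n/2$, the generalized Petersen graph $GP(n,k)$ has vertex set $\{u_i: i\in\mathbb{Z}_n\}\cup\{v_i: i\in\mathbb{Z}_n\}$ and edge set $\{u_iu_{i+1}: i\in\mathbb{Z}_n\}\cup\{v_iv_{i+k}: i\in\mathbb{Z}_n\}\cup\{u_iv_i: i\in\mathbb{Z}_n\}$. *)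

theory Defs
  imports Complex_Main "Graph_Theory.Graph_Theory"
begin

section \<open>Distance and diameter\<close>

text \<open>
  Undirected simple graphs are loop-free symmetric digraphs (locale \<^locale>\<open>graph\<close>): an edge
  is a pair of opposite arcs, and a path in the undirected sense is a directed path.
  The distance is only meaningful if there is a path; it is used for connected graphs only.
\<close>

definition graph_dist :: "('a, 'b) pre_digraph \<Rightarrow> 'a \<Rightarrow> 'a \<Rightarrow> nat" where
  "graph_dist G x y = (LEAST l. \<exists>p. pre_digraph.apath G x p y \<and> length p = l)"

definition graph_diameter :: "('a, 'b) pre_digraph \<Rightarrow> nat" where
  "graph_diameter G = Max {graph_dist G x y | x y. x \<in> verts G \<and> y \<in> verts G}"

section \<open>Distance-balanced graphs\<close>

definition closer_verts :: "('a, 'b) pre_digraph \<Rightarrow> 'a \<Rightarrow> 'a \<Rightarrow> 'a set" where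
  "closer_verts G x y = {w \<in> verts G. graph_dist G w x < graph_dist G w y}"

definition distance_balanced :: "nat \<Rightarrow> ('a, 'b) pre_digraph \<Rightarrow> bool" where
  "distance_balanced l G \<longleftrightarrow>
     graph G \<and> connected G \<and> l \<le> graph_diameter G \<and>
     (\<forall>x \<in> verts G. \<forall>y \<in> verts G. graph_dist G x y = l \<longrightarrow>
        card (closer_verts G x y) = card (closer_verts G y x))"

section \<open>Generalized Petersen graphs\<close>

text \<open>The index set \<open>\<int>\<^sub>n\<close> is represented by the residues \<open>{..<n}\<close>.\<close>

datatype gp_vertex = U nat | V nat

definition GP_verts :: "nat \<Rightarrow> gp_vertex set" where
  "GP_verts n = U ` {..<n} \<union> V ` {..<n}"

definition GP_edges :: "nat \<Rightarrow> nat \<Rightarrow> (gp_vertex \<times> gp_vertex) set" where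
  "GP_edges n k =
     {(U i, U ((i + 1) mod n)) | i. i < n} \<union>
     {(V i, V ((i + k) mod n)) | i. i < n} \<union>
     {(U i, V i) | i. i < n}"

definition GP :: "nat \<Rightarrow> nat \<Rightarrow> (gp_vertex, gp_vertex \<times> gp_vertex) pre_digraph" where
  "GP n k = \<lparr> verts = GP_verts n, arcs = GP_edges n k \<union> (GP_edges n k)\<inverse>,
              tail = fst, head = snd \<rparr>"

section \<open>Sanity checks\<close>

lemma (in graph) mu_eq_graph_dist:
  assumes "x \<rightarrow>\<^sup>* y"
  shows "\<mu> (\<lambda>_. 1) x y = ereal (real (graph_dist G x y))"
proof -
  have cost: "awalk_cost (\<lambda>_. 1) p = real (length p)" for p
    by (induction p) auto
  obtain p where p: "apath x p y" "\<mu> (\<lambda>_. 1) x y = ereal (awalk_cost (\<lambda>_. 1) p)"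
    using min_cost_awalk[OF assms, of "\<lambda>_. 1"] by auto
  have "length p \<le> length q" if "apath x q y" for q
    using min_cost_le_walk_cost[of x q y "\<lambda>_. 1"] that p(2) cost
    by (simp add: apath_def)
  then have "graph_dist G x y = length p"
    unfolding graph_dist_def by (intro Least_equality) (use p(1) in auto)
  then show ?thesis using p(2) cost by simp
qed

lemma graph_GP:
  assumes "1 \<le> k" "2 * k < n"
  shows "graph (GP n k)"
proof -
  have fin: "finite (GP_edges n k)"
    unfolding GP_edges_def by simp
  have sub: "GP_edges n k \<subseteq> GP_verts n \<times> GP_verts n"
    unfolding GP_edges_def GP_verts_def by (auto intro!: imageI)
  have neq: "(i + d) mod n \<noteq> i" if "0 < d" "d < n" "i < n" for i d
  proof (cases "i + d < n")
    case False
    then have "(i + d) mod n = i + d - n"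
      using that by (simp add: mod_if)
    then show ?thesis using that False by linarith
  qed (use that in simp)
  have irr: "x \<noteq> y" if "(x, y) \<in> GP_edges n k" for x y
    using that neq[of 1] neq[of k] assms unfolding GP_edges_def
    by (auto; metis)
  interpret wf_digraph "GP n k"
    by unfold_locales (use sub in \<open>auto simp: GP_def\<close>)
  show ?thesis
  proof unfold_locales
    show "finite (verts (GP n k))" by (simp add: GP_def GP_verts_def)
    show "finite (arcs (GP n k))" using fin by (simp add: GP_def)
    show "tail (GP n k) e \<noteq> head (GP n k) e" if "e \<in> arcs (GP n k)" for e
      using that irr by (cases e) (fastforce simp: GP_def)
    show "e1 = e2" if "arc_to_ends (GP n k) e1 = arc_to_ends (GP n k) e2" for e1 e2
      using that by (simp add: GP_def arc_to_ends_def prod_eq_iff)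
    show "symmetric (GP n k)"
      by (force simp: GP_def symmetric_conv)
  qed
qed

lemma connected_GP:
  assumes "1 \<le> k" "2 * k < n"
  shows "connected (GP n k)"
proof -
  interpret graph "GP n k" using graph_GP[OF assms] .
  have arcI: "x \<rightarrow>\<^bsub>GP n k\<^esub> y \<and> y \<rightarrow>\<^bsub>GP n k\<^esub> x" if "(x, y) \<in> GP_edges n k" for x y
    using that by (force simp: GP_def arcs_ends_conv)
  have U: "U 0 \<rightarrow>\<^sup>*\<^bsub>GP n k\<^esub> U i \<and> U i \<rightarrow>\<^sup>*\<^bsub>GP n k\<^esub> U 0" if "i < n" for i
    using that
  proof (induction i)
    case 0
    then have "U 0 \<in> verts (GP n k)" by (simp add: GP_def GP_verts_def)
    then show ?case by simp
  next
    case (Suc i)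
    have "(U i, U (Suc i)) \<in> GP_edges n k"
      using Suc.prems by (force simp: GP_edges_def)
    with Suc arcI show ?case
      by (meson Suc_lessD adj_reachable_trans reachable_adj_trans)
  qed
  have V: "U 0 \<rightarrow>\<^sup>*\<^bsub>GP n k\<^esub> V i \<and> V i \<rightarrow>\<^sup>*\<^bsub>GP n k\<^esub> U 0" if "i < n" for i
  proof -
    have "(U i, V i) \<in> GP_edges n k" using that by (auto simp: GP_edges_def)
    with arcI U[OF that] show ?thesis
      by (meson adj_reachable_trans reachable_adj_trans)
  qed
  have "strongly_connected (GP n k)"
  proof (rule strongly_connectedI)
    show "verts (GP n k) \<noteq> {}" using assms by (auto simp: GP_def GP_verts_def)
    fix x y assume "x \<in> verts (GP n k)" "y \<in> verts (GP n k)"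
    then have "x \<rightarrow>\<^sup>*\<^bsub>GP n k\<^esub> U 0" "U 0 \<rightarrow>\<^sup>*\<^bsub>GP n k\<^esub> y"
      using U V by (auto simp: GP_def GP_verts_def)
    then show "x \<rightarrow>\<^sup>*\<^bsub>GP n k\<^esub> y" by (rule reachable_trans)
  qed
  then show ?thesis
    using reachable_mk_symmetricI unfolding connected_def strongly_connected_def
    by (auto simp: mk_symmetric_def)
qed

lemma graph_diameter_GP:
  assumes "1 \<le> k" "2 * k < n"
  shows "2 \<le> graph_diameter (GP n k)"
proof -
  interpret graph "GP n k" using graph_GP[OF assms] .
  let ?d = "graph_dist (GP n k) (U 0) (V 1)"
  have verts: "U 0 \<in> verts (GP n k)" "V 1 \<in> verts (GP n k)"
    using assms by (auto simp: GP_def GP_verts_def)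
  have "U 0 \<rightarrow>\<^sup>*\<^bsub>GP n k\<^esub> V 1"
    using connected_GP[OF assms] verts
      symmetric_connected_imp_strongly_connected[OF sym_arcs] by blast
  then obtain q where "apath (U 0) q (V 1)"
    using min_cost_awalk[of "U 0" "V 1" "\<lambda>_. 1"] by auto
  then have "\<exists>p. apath (U 0) p (V 1) \<and> length p = ?d"
    unfolding graph_dist_def
    by (intro LeastI[of "\<lambda>l. \<exists>p. apath (U 0) p (V 1) \<and> length p = l"] exI conjI) auto
  then obtain p where p: "apath (U 0) p (V 1)" "length p = ?d" by blast
  have "\<not> (tail (GP n k) e = U 0 \<and> head (GP n k) e = V 1)" if "e \<in> arcs (GP n k)" for e
    using that by (auto simp: GP_def GP_edges_def)
  then have "length p \<noteq> 0" "length p \<noteq> 1"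
    using p(1) by (auto simp: apath_simps length_Suc_conv)
  then have "2 \<le> ?d" using p(2) by linarith
  moreover have "finite {graph_dist (GP n k) x y | x y. x \<in> verts (GP n k) \<and> y \<in> verts (GP n k)}"
    by (rule finite_image_set2) auto
  then have "?d \<le> graph_diameter (GP n k)"
    unfolding graph_diameter_def by (rule Max_ge) (use verts in blast)
  ultimately show ?thesis by linarith
qed

end

theory Submission
  imports Defs
begin

text \<open>
  Let \<open>f j\<close> be the distance from \<open>0\<close> to \<open>j\<close> in the circulant graph on \<open>\<int>\<^sub>n\<close> with steps \<open>\<plusminus>1, \<plusminus>k\<close>.
  In \<open>GP(n,k)\<close> the distance between \<open>u\<^sub>0\<close> and \<open>v\<^sub>j\<close> is \<open>f j + 1\<close>, and for two vertices of the same
  kind with index difference \<open>j\<close> it is \<open>f j + 2\<close>, except that staying on the outer cycle or on the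
  inner cycles may save the two spokes.

  Pairs at distance 2 of the same kind are interchanged by a reflection, so only
  \<open>{u\<^sub>0, v\<^sub>1}\<close> and \<open>{u\<^sub>0, v\<^sub>k}\<close> matter. For \<open>{u\<^sub>0, v\<^sub>1}\<close>, if all distances were generic, the vertices
  with index \<open>j\<close> would contribute \<open>f j - f (j - 1)\<close> to the difference \<open>|W\<^sub>v\<^sub>u| - |W\<^sub>u\<^sub>v|\<close>, which telescopes
  to 0. The shortcuts along the outer cycle only occur for \<open>j\<close> close to 0 and cost at most
  \<open>2 \<lfloor>k/2\<rfloor> + 3\<close> in total (when \<open>k \<ge> 3\<close>), whereas every multiple \<open>tk\<close> with \<open>(2|t| - 1) k < n\<close> gains at
  least 1 through the inner shortcut to \<open>v\<^sub>j\<close>, \<open>j = tk + 1\<close>. With \<open>t\<close> ranging over \<open>\<lfloor>k/2\<rfloor> + 2\<close> positive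
  and \<open>\<lfloor>k/2\<rfloor> + 1\<close> negative values and 0 the gain wins as soon as \<open>n > k (2 \<lfloor>k/2\<rfloor> + 3)\<close>. The finitely
  many remaining graphs are evaluated.
\<close>

section \<open>Norms on the integers modulo \<open>n\<close>\<close>

definition cyc_norm :: "int \<Rightarrow> int \<Rightarrow> int" where
  "cyc_norm n x = min (x mod n) ((- x) mod n)"

text \<open>Here \<open>t\<close> counts the signed steps by \<open>k\<close>, and steps by 1 cover
  the remainder. Letting \<open>t\<close> run over one system of residues keeps the minimum finite
  and computable.\<close>

definition circ_norm :: "int \<Rightarrow> int \<Rightarrow> int \<Rightarrow> int" where
  "circ_norm n k x = Min ((\<lambda>t. cyc_norm n t + cyc_norm n (x - t * k)) ` {0..<n})"

text \<open>The distance between two outer vertices with index difference \<open>x\<close>: stay on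
  the outer cycle, or pay two spokes for a circulant walk.\<close>

definition outer_norm :: "int \<Rightarrow> int \<Rightarrow> int \<Rightarrow> int" where
  "outer_norm n k x = min (cyc_norm n x) (circ_norm n k x + 2)"

text \<open>The distance between two inner vertices. The inner edges need not connect all indices,
  so a walk without spokes is available only for those \<open>t\<close> with \<open>x\<close>
  congruent to \<open>t * k\<close>; for every other \<open>t\<close> the remainder is covered by
  outer steps at the price of two spokes.\<close>

definition inner_norm :: "int \<Rightarrow> int \<Rightarrow> int \<Rightarrow> int" where
  "inner_norm n k x =
     Min ((\<lambda>t. cyc_norm n t + (if n dvd x - t * k then 0 else cyc_norm n (x - t * k) + 2)) ` {0..<n})"

text \<open>Together with \<open>cyc_norm_attained\<close> this describes
  \<open>cyc_norm n x\<close> as the least absolute value in the residue class of \<open>x\<close>,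
  the form in which most later arguments use it.\<close>

lemma cyc_norm_le:
  assumes "0 < n" "n dvd x - y"
  shows "cyc_norm n x \<le> \<bar>y\<bar>"
proof -
  have "x mod n = y mod n" using assms by (simp add: mod_eq_dvd_iff)
  moreover from this have "(- x) mod n = (- y) mod n" by (rule mod_minus_cong)
  ultimately show ?thesis
    using zmod_le_nonneg_dividend[of y n] zmod_le_nonneg_dividend[of "- y" n]
    by (auto simp: cyc_norm_def abs_if)
qed

lemma cyc_norm_attained:
  assumes "0 < n"
  obtains y where "n dvd x - y" "cyc_norm n x = \<bar>y\<bar>"
proof -
  have "\<exists>y. n dvd x - y \<and> cyc_norm n x = \<bar>y\<bar>"
  proof (cases "x mod n \<le> (- x) mod n")
    case True
    then show ?thesis using assms
      by (intro exI[of _ "x mod n"]) (auto simp: cyc_norm_def)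
  next
    case False
    have "n dvd (- x) - (- x) mod n" by simp
    then have "n dvd - ((- x) - (- x) mod n)" by (simp only: dvd_minus_iff)
    then show ?thesis using assms False
      by (intro exI[of _ "- ((- x) mod n)"]) (auto simp: cyc_norm_def algebra_simps)
  qed
  then show ?thesis using that by blast
qed

lemma cyc_norm_cong: "n dvd x - y \<Longrightarrow> cyc_norm n x = cyc_norm n y"
  by (metis cyc_norm_def mod_eq_dvd_iff mod_minus_cong)

text \<open>Distinct congruent integers differ by at least \<open>n\<close>, so no representative
  lies closer to 0 than one of absolute value at most \<open>n / 2\<close>.\<close>

lemma cyc_norm_eq_abs:
  assumes "0 < n" "2 * \<bar>x\<bar> \<le> n"
  shows "cyc_norm n x = \<bar>x\<bar>"
proof -
  obtain y where y: "n dvd x - y" "cyc_norm n x = \<bar>y\<bar>"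
    using cyc_norm_attained[OF assms(1)] by blast
  have "\<bar>x\<bar> \<le> \<bar>y\<bar>"
  proof (rule ccontr)
    assume "\<not> ?thesis"
    then have "\<bar>x - y\<bar> < n" "x - y \<noteq> 0" using assms by auto
    then show False using zdvd_imp_le[of n "\<bar>x - y\<bar>"] y(1) by auto
  qed
  then show ?thesis using y cyc_norm_le[OF assms(1), of x x] by auto
qed

locale circulant =
  fixes n k :: int
  assumes n_pos: "0 < n"
begin

abbreviation "f \<equiv> circ_norm n k"
abbreviation "a \<equiv> outer_norm n k"
abbreviation "c \<equiv> inner_norm n k"

text \<open>With \<open>circ_norm_attained\<close> this makes \<open>f x\<close> the least
  \<bar>s\<bar> + \<bar>t\<bar> over all integers \<open>s\<close>, \<open>t\<close> with
  \<open>s + t * k\<close> congruent to \<open>x\<close>, free of any range restriction on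
  \<open>t\<close>.\<close>

lemma circ_norm_le:
  assumes "n dvd x - s - t * k"
  shows "f x \<le> \<bar>s\<bar> + \<bar>t\<bar>"
proof -
  have "n dvd t - t mod n" by simp
  then have "n dvd (x - s - t * k) + (t - t mod n) * k" using assms by simp
  then have "n dvd (x - t mod n * k) - s" by (simp add: algebra_simps)
  then have "cyc_norm n (x - t mod n * k) \<le> \<bar>s\<bar>" by (rule cyc_norm_le[OF n_pos])
  moreover have "cyc_norm n (t mod n) \<le> \<bar>t\<bar>"
    by (rule cyc_norm_le[OF n_pos]) (simp add: dvd_diff_commute)
  moreover have "f x \<le> cyc_norm n (t mod n) + cyc_norm n (x - t mod n * k)"
    unfolding circ_norm_def using n_pos by (intro Min_le) auto
  ultimately show ?thesis by linarith
qed

lemma circ_norm_attained: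
  obtains s t where "n dvd x - s - t * k" "f x = \<bar>s\<bar> + \<bar>t\<bar>"
proof -
  have "f x \<in> (\<lambda>t. cyc_norm n t + cyc_norm n (x - t * k)) ` {0..<n}"
    unfolding circ_norm_def using n_pos by (intro Min_in) auto
  then obtain t0 where t0: "f x = cyc_norm n t0 + cyc_norm n (x - t0 * k)" by blast
  obtain t where t: "n dvd t0 - t" "cyc_norm n t0 = \<bar>t\<bar>"
    using cyc_norm_attained[OF n_pos] by blast
  obtain s where s: "n dvd (x - t0 * k) - s" "cyc_norm n (x - t0 * k) = \<bar>s\<bar>"
    using cyc_norm_attained[OF n_pos] by blast
  have "n dvd ((x - t0 * k) - s) + (t0 - t) * k" using s t by simp
  then have "n dvd x - s - t * k" by (simp add: algebra_simps)
  then show ?thesis using that t0 s t by simp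
qed

lemma circ_norm_nonneg [simp]: "0 \<le> f x"
  by (rule circ_norm_attained[of x]) auto

lemma circ_norm_cong: "n dvd x - y \<Longrightarrow> f x = f y"
  unfolding circ_norm_def
  by (intro arg_cong[where f = Min] image_cong refl arg_cong2[where f = "(+)"] cyc_norm_cong)
    (simp add: algebra_simps)

lemma circ_norm_minus: "f (- x) = f x"
proof -
  have *: "f (- y) \<le> f y" for y
  proof (rule circ_norm_attained[of y])
    fix s t assume st: "n dvd y - s - t * k" "f y = \<bar>s\<bar> + \<bar>t\<bar>"
    have "n dvd - (y - s - t * k)" using st by (simp only: dvd_minus_iff)
    then have "n dvd - y - (- s) - (- t) * k" by (simp add: algebra_simps)
    from circ_norm_le[OF this] st show ?thesis by simp
  qed
  from *[of x] *[of "- x"] show ?thesis by simp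
qed

text \<open>One more edge changes one coefficient of an optimal representation by one. Such step
  lemmas make the norms suitable as distance potentials.\<close>

lemma circ_norm_step:
  assumes "n dvd y - x - e" "e \<in> {1, -1, k, -k}"
  shows "f y \<le> f x + 1"
proof (rule circ_norm_attained[of x])
  fix s t assume st: "n dvd x - s - t * k" "f x = \<bar>s\<bar> + \<bar>t\<bar>"
  have *: "n dvd (y - x - e) + (x - s - t * k)" using assms st by (intro dvd_add)
  have "\<exists>s' t'. n dvd y - s' - t' * k \<and> \<bar>s'\<bar> + \<bar>t'\<bar> \<le> \<bar>s\<bar> + \<bar>t\<bar> + 1"
    using assms(2)
  proof (elim insertE emptyE)
    assume "e = 1" then show ?thesis using * by (intro exI[of _ "s + 1"] exI[of _ t]) (auto simp: algebra_simps)
  next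
    assume "e = - 1" then show ?thesis using * by (intro exI[of _ "s - 1"] exI[of _ t]) (auto simp: algebra_simps)
  next
    assume "e = k" then show ?thesis using * by (intro exI[of _ "s"] exI[of _ "t + 1"]) (auto simp: algebra_simps)
  next
    assume "e = - k" then show ?thesis using * by (intro exI[of _ "s"] exI[of _ "t - 1"]) (auto simp: algebra_simps)
  qed
  then show ?thesis using circ_norm_le[of y] st(2) by (metis order_trans)
qed

lemma circ_norm_diff_le: "\<bar>f x - f (x - 1)\<bar> \<le> 1"
  using circ_norm_step[of x "x - 1" 1] circ_norm_step[of "x - 1" x "- 1"] by auto

lemma circ_norm_le_cyc: "f x \<le> cyc_norm n x"
  by (rule cyc_norm_attained[OF n_pos, of x]) (use circ_norm_le[of x _ 0] in auto)

lemma inner_norm_le_abs: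
  assumes "n dvd x - t * k"
  shows "c x \<le> \<bar>t\<bar>"
proof -
  have "n dvd t - t mod n" by simp
  then have "n dvd (x - t * k) + (t - t mod n) * k" using assms by simp
  then have "n dvd (x - t mod n * k)" by (simp add: algebra_simps)
  moreover have "cyc_norm n (t mod n) \<le> \<bar>t\<bar>"
    by (rule cyc_norm_le[OF n_pos]) (simp add: dvd_diff_commute)
  moreover have "c x \<le> cyc_norm n (t mod n) +
      (if n dvd x - t mod n * k then 0 else cyc_norm n (x - t mod n * k) + 2)"
    unfolding inner_norm_def using n_pos by (intro Min_le) auto
  ultimately show ?thesis by auto
qed

lemma inner_norm_le: "c x \<le> f x + 2"
proof -
  have "f x \<in> (\<lambda>t. cyc_norm n t + cyc_norm n (x - t * k)) ` {0..<n}"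
    unfolding circ_norm_def using n_pos by (intro Min_in) auto
  then obtain t where t: "f x = cyc_norm n t + cyc_norm n (x - t * k)" "t \<in> {0..<n}" by blast
  then have "c x \<le> cyc_norm n t + (if n dvd x - t * k then 0 else cyc_norm n (x - t * k) + 2)"
    unfolding inner_norm_def using n_pos by (intro Min_le) auto
  moreover have "0 \<le> cyc_norm n (x - t * k)"
    by (rule cyc_norm_attained[OF n_pos, of "x - t * k"]) auto
  ultimately show ?thesis using t(1) by (auto split: if_splits)
qed

text \<open>Gives \<open>c\<close> the same two-way shape as \<open>a\<close>: a minimising walk
  either has no spokes, or it uses two and is then a shortest circulant walk.\<close>

lemma inner_norm_cases:
  obtains "c x = f x + 2" | t where "n dvd x - t * k" "c x = \<bar>t\<bar>"
proof -
  have "c x \<in> (\<lambda>t. cyc_norm n t + (if n dvd x - t * k then 0 else cyc_norm n (x - t * k) + 2)) ` {0..<n}"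
    unfolding inner_norm_def using n_pos by (intro Min_in) auto
  then obtain t0 where t0: "t0 \<in> {0..<n}"
    "c x = cyc_norm n t0 + (if n dvd x - t0 * k then 0 else cyc_norm n (x - t0 * k) + 2)" by blast
  show ?thesis
  proof (cases "n dvd x - t0 * k")
    case True
    obtain t where t: "n dvd t0 - t" "cyc_norm n t0 = \<bar>t\<bar>"
      using cyc_norm_attained[OF n_pos] by blast
    have "n dvd (x - t0 * k) + (t0 - t) * k" using True t by simp
    then have "n dvd x - t * k" by (simp add: algebra_simps)
    then show ?thesis using that t0 t True by simp
  next
    case False
    have "f x \<le> cyc_norm n t0 + cyc_norm n (x - t0 * k)"
      unfolding circ_norm_def using n_pos t0 by (intro Min_le) auto
    then show ?thesis using that t0 False inner_norm_le[of x] by auto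
  qed
qed

lemma circ_norm_le_inner: "f x \<le> c x"
  by (rule inner_norm_cases[of x]) (use circ_norm_le[of x 0] in auto)

lemma inner_norm_cong: "n dvd x - y \<Longrightarrow> c x = c y"
proof -
  assume xy: "n dvd x - y"
  have "n dvd x - t * k \<longleftrightarrow> n dvd y - t * k" for t
    using dvd_add_right_iff[OF xy, of "y - t * k"] by simp
  moreover have "cyc_norm n (x - t * k) = cyc_norm n (y - t * k)" for t
    using xy by (intro cyc_norm_cong) simp
  ultimately show ?thesis
    unfolding inner_norm_def by (intro arg_cong[where f = Min] image_cong) simp_all
qed

lemma inner_norm_minus: "c (- x) = c x"
proof -
  have *: "c (- y) \<le> c y" for y
  proof (rule inner_norm_cases[of y])
    assume "c y = f y + 2"
    then show ?thesis using inner_norm_le[of "- y"] by (simp add: circ_norm_minus)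
  next
    fix t assume t: "n dvd y - t * k" "c y = \<bar>t\<bar>"
    have "n dvd - (y - t * k)" using t by (simp only: dvd_minus_iff)
    then have "n dvd - y - (- t) * k" by (simp add: algebra_simps)
    from inner_norm_le_abs[OF this] t show ?thesis by simp
  qed
  from *[of x] *[of "- x"] show ?thesis by simp
qed

lemma inner_norm_step:
  assumes "n dvd y - x - e" "e \<in> {k, -k}"
  shows "c y \<le> c x + 1"
proof (rule inner_norm_cases[of x])
  assume "c x = f x + 2"
  then show ?thesis using inner_norm_le[of y] circ_norm_step[of y x e] assms by auto
next
  fix t assume t: "n dvd x - t * k" "c x = \<bar>t\<bar>"
  have *: "n dvd (y - x - e) + (x - t * k)" using assms t by (intro dvd_add)
  have "\<exists>t'. n dvd y - t' * k \<and> \<bar>t'\<bar> \<le> \<bar>t\<bar> + 1"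
    using assms(2)
  proof (elim insertE emptyE)
    assume "e = k" then show ?thesis using * by (intro exI[of _ "t + 1"]) (auto simp: algebra_simps)
  next
    assume "e = - k" then show ?thesis using * by (intro exI[of _ "t - 1"]) (auto simp: algebra_simps)
  qed
  then show ?thesis using inner_norm_le_abs[of y] t(2) by (metis order_trans)
qed

lemma outer_norm_step:
  assumes "n dvd y - x - e" "e \<in> {1, -1}"
  shows "a y \<le> a x + 1"
proof -
  obtain x' where x': "n dvd x - x'" "cyc_norm n x = \<bar>x'\<bar>"
    using cyc_norm_attained[OF n_pos] by blast
  have "n dvd (y - x - e) + (x - x')" using assms(1) x'(1) by (rule dvd_add)
  then have "n dvd y - (x' + e)" by (simp add: algebra_simps)
  then have "cyc_norm n y \<le> \<bar>x' + e\<bar>" by (rule cyc_norm_le[OF n_pos])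
  then have "cyc_norm n y \<le> cyc_norm n x + 1" using x'(2) assms(2) by auto
  moreover have "f y \<le> f x + 1" using circ_norm_step[of y x e] assms by auto
  ultimately show ?thesis by (auto simp: outer_norm_def)
qed

lemma outer_norm_cong: "n dvd x - y \<Longrightarrow> a x = a y"
  by (simp add: outer_norm_def circ_norm_cong[of x y] cyc_norm_cong[of n x y])

lemma cyc_norm_minus: "cyc_norm n (- x) = cyc_norm n x"
  by (simp add: cyc_norm_def min.commute)

lemma outer_norm_minus: "a (- x) = a x"
  by (simp add: outer_norm_def circ_norm_minus cyc_norm_minus)

lemma circ_norm_le_outer: "f x \<le> a x"
  using circ_norm_le_cyc[of x] by (simp add: outer_norm_def)

lemma outer_norm_le: "a x \<le> f x + 2"
  by (simp add: outer_norm_def)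

lemma zero_norms [simp]: "f 0 = 0" "a 0 = 0" "c 0 = 0"
  using circ_norm_le[of 0 0 0] inner_norm_le_abs[of 0 0] circ_norm_le_inner[of 0]
    circ_norm_nonneg[of 0] by (auto simp: outer_norm_def cyc_norm_def simp del: circ_norm_nonneg)

lemma cyc_norm_descend:
  assumes "\<not> n dvd x"
  obtains e where "e \<in> {1, -1}" "cyc_norm n (x + e) < cyc_norm n x"
proof -
  obtain y where y: "n dvd x - y" "cyc_norm n x = \<bar>y\<bar>"
    using cyc_norm_attained[OF n_pos] by blast
  have "y \<noteq> 0" using y assms by auto
  have "cyc_norm n (x - sgn y) \<le> \<bar>y - sgn y\<bar>"
    using y by (intro cyc_norm_le[OF n_pos]) auto
  also have "\<dots> < \<bar>y\<bar>" using \<open>y \<noteq> 0\<close> by (auto simp: sgn_if)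
  finally show ?thesis using y \<open>y \<noteq> 0\<close> by (intro that[of "- sgn y"]) (auto simp: sgn_if)
qed

text \<open>For walks towards an outer vertex: unless crossing the spoke, which leads to the value
  \<open>f x + 1\<close>, already decreases the distance, an outer step does. The inner version
  follows the same pattern.\<close>

lemma outer_norm_descend:
  assumes "\<not> n dvd x"
  shows "f x + 1 < a x \<or> (\<exists>e \<in> {1, -1}. a (x + e) < a x)"
proof (cases "a x = f x + 2")
  case False
  then have "a x = cyc_norm n x" by (simp add: outer_norm_def min_def split: if_splits)
  then show ?thesis using cyc_norm_descend[OF assms] unfolding outer_norm_def
    by (metis min.strict_coboundedI1)
qed simp

lemma inner_norm_descend:
  assumes "\<not> n dvd x"
  shows "f x + 1 < c x \<or> (\<exists>e \<in> {k, -k}. c (x + e) < c x)"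
proof (rule inner_norm_cases[of x])
  fix t assume t: "n dvd x - t * k" "c x = \<bar>t\<bar>"
  have "t \<noteq> 0" using t assms by auto
  have "n dvd (x - sgn t * k) - (t - sgn t) * k" using t by (simp add: algebra_simps)
  then have "c (x - sgn t * k) \<le> \<bar>t - sgn t\<bar>" by (rule inner_norm_le_abs)
  also have "\<dots> < \<bar>t\<bar>" using \<open>t \<noteq> 0\<close> by (auto simp: sgn_if)
  finally show ?thesis using t \<open>t \<noteq> 0\<close> by (auto simp: sgn_if split: if_splits)
qed simp

text \<open>For walks from an inner to an outer vertex: if an optimal representation has
  \<open>t = 0\<close>, no inner step is needed and the spoke can be taken at once; otherwise one of
  its inner steps is taken first.\<close>

lemma spoke_descend_outer: "a x < f x + 1 \<or> (\<exists>e \<in> {k, -k}. f (x + e) < f x)"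
proof (rule circ_norm_attained[of x])
  fix s t assume st: "n dvd x - s - t * k" "f x = \<bar>s\<bar> + \<bar>t\<bar>"
  show ?thesis
  proof (cases "t = 0")
    case True
    then have "cyc_norm n x \<le> \<bar>s\<bar>" using st by (intro cyc_norm_le[OF n_pos]) simp
    then show ?thesis using st True by (simp add: outer_norm_def)
  next
    case False
    have "n dvd (x - sgn t * k) - s - (t - sgn t) * k" using st by (simp add: algebra_simps)
    then have "f (x - sgn t * k) \<le> \<bar>s\<bar> + \<bar>t - sgn t\<bar>" by (rule circ_norm_le)
    also have "\<dots> < \<bar>s\<bar> + \<bar>t\<bar>" using \<open>t \<noteq> 0\<close> by (auto simp: sgn_if)
    finally show ?thesis using st \<open>t \<noteq> 0\<close> by (auto simp: sgn_if split: if_splits)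
  qed
qed

lemma spoke_descend_inner: "c x < f x + 1 \<or> (\<exists>e \<in> {1, -1}. f (x + e) < f x)"
proof (rule circ_norm_attained[of x])
  fix s t assume st: "n dvd x - s - t * k" "f x = \<bar>s\<bar> + \<bar>t\<bar>"
  show ?thesis
  proof (cases "s = 0")
    case True
    then have "c x \<le> \<bar>t\<bar>" using st by (intro inner_norm_le_abs) simp
    then show ?thesis using st True by simp
  next
    case False
    have "n dvd (x - sgn s) - (s - sgn s) - t * k" using st by (simp add: algebra_simps)
    then have "f (x - sgn s) \<le> \<bar>s - sgn s\<bar> + \<bar>t\<bar>" by (rule circ_norm_le)
    also have "\<dots> < \<bar>s\<bar> + \<bar>t\<bar>" using \<open>s \<noteq> 0\<close> by (auto simp: sgn_if)
    finally show ?thesis using st \<open>s \<noteq> 0\<close> by (auto simp: sgn_if split: if_splits)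
  qed
qed

end

section \<open>Distances in the generalized Petersen graph\<close>

text \<open>A potential argument: changing by at most 1 along arcs makes \<open>h\<close> a lower
  bound for walk lengths, and following decreasing neighbours down to \<open>x\<close> produces a
  walk of length at most \<open>h\<close>.\<close>

lemma (in graph) graph_dist_eqI:
  fixes h :: "'a \<Rightarrow> int"
  assumes x: "x \<in> verts G" "h x = 0"
    and nonneg: "\<And>w. 0 \<le> h w"
    and step: "\<And>v w. v \<rightarrow> w \<Longrightarrow> h v \<le> h w + 1"
    and descend: "\<And>w. w \<in> verts G \<Longrightarrow> w \<noteq> x \<Longrightarrow> \<exists>v. w \<rightarrow> v \<and> h v < h w"
    and w: "w \<in> verts G"
  shows "int (graph_dist G w x) = h w"
proof -
  have lower: "h v \<le> int (length p)" if "awalk v p x" for v p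
    using that
  proof (induction p arbitrary: v)
    case Nil
    then show ?case using x by (simp add: awalk_Nil_iff)
  next
    case (Cons e p)
    then have "v \<rightarrow> head G e" "awalk (head G e) p x"
      by (auto simp: awalk_Cons_iff dest: in_arcs_imp_in_arcs_ends)
    then show ?case using step Cons.IH by fastforce
  qed
  have upper: "\<exists>p. awalk v p x \<and> int (length p) \<le> h v" if "v \<in> verts G" for v
    using that
  proof (induction "nat (h v)" arbitrary: v rule: less_induct)
    case less
    show ?case
    proof (cases "v = x")
      case True
      then show ?thesis using x by (intro exI[of _ "[]"]) (simp add: awalk_Nil_iff)
    next
      case False
      then obtain u where u: "v \<rightarrow> u" "h u < h v" using descend less.prems by blast
      then obtain p where p: "awalk u p x" "int (length p) \<le> h u"
        using less.hyps[of u] nonneg[of u] adj_in_verts(2)[OF u(1)] by auto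
      from u(1) obtain e where "e \<in> arcs G" "tail G e = v" "head G e = u"
        by (auto simp: arcs_ends_conv)
      then have "awalk v (e # p) x" using p by (auto simp: awalk_Cons_iff)
      then show ?thesis using p u by (intro exI[of _ "e # p"]) auto
    qed
  qed
  obtain p where p: "awalk w p x" "int (length p) \<le> h w" using upper[OF w] by blast
  then have reach: "w \<rightarrow>\<^sup>* x" by (auto simp: reachable_awalk)
  \<comment> \<open>Unit weights link the two notions of length: \<open>graph_dist\<close> minimises
    over paths, the bounds above concern walks.\<close>
  have cost: "awalk_cost (\<lambda>_. 1) q = real (length q)" for q
    by (induction q) auto
  obtain q where q: "apath w q x" "\<mu> (\<lambda>_. 1) w x = ereal (awalk_cost (\<lambda>_. 1) q)"
    using min_cost_awalk[OF reach, of "\<lambda>_. 1"] by auto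
  have "length q = graph_dist G w x"
    using q(2) mu_eq_graph_dist[OF reach] cost by simp
  moreover have "h w \<le> int (length q)" using lower q(1) by (auto simp: apath_def)
  moreover have "graph_dist G w x \<le> length p"
    using min_cost_le_walk_cost[OF p(1), of "\<lambda>_. 1"] mu_eq_graph_dist[OF reach] cost by simp
  ultimately show ?thesis using p(2) by linarith
qed

fun gp_dist :: "int \<Rightarrow> int \<Rightarrow> gp_vertex \<Rightarrow> gp_vertex \<Rightarrow> int" where
  "gp_dist n k (U i) (U j) = outer_norm n k (int i - int j)"
| "gp_dist n k (U i) (V j) = circ_norm n k (int i - int j) + 1"
| "gp_dist n k (V i) (U j) = circ_norm n k (int i - int j) + 1"
| "gp_dist n k (V i) (V j) = inner_norm n k (int i - int j)"

lemma eq_add_mod_iff: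
  fixes i j e n :: nat
  assumes "0 < n"
  shows "j = (i + e) mod n \<longleftrightarrow> j < n \<and> int n dvd int j - int i - int e"
proof -
  have "j = (i + e) mod n \<longleftrightarrow> j < n \<and> j mod n = (i + e) mod n" using assms by auto
  also have "j mod n = (i + e) mod n \<longleftrightarrow> int j mod int n = int (i + e) mod int n"
    by (metis of_nat_mod of_nat_eq_iff)
  also have "\<dots> \<longleftrightarrow> int n dvd int j - int i - int e"
    by (simp add: mod_eq_dvd_iff algebra_simps)
  finally show ?thesis .
qed

lemma GP_verts_iff [simp]: "U i \<in> verts (GP n k) \<longleftrightarrow> i < n" "V i \<in> verts (GP n k) \<longleftrightarrow> i < n"
  by (auto simp: GP_def GP_verts_def)

lemma arcs_ends_GP: "arcs_ends (GP n k) = GP_edges n k \<union> (GP_edges n k)\<inverse>"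
  by (auto simp: arcs_ends_conv GP_def)

lemma GP_adj_iff:
  assumes "0 < n"
  shows "U i \<rightarrow>\<^bsub>GP n k\<^esub> U j \<longleftrightarrow>
      i < n \<and> j < n \<and> (\<exists>e \<in> {1, -1}. int n dvd int j - int i - e)"
    "V i \<rightarrow>\<^bsub>GP n k\<^esub> V j \<longleftrightarrow>
      i < n \<and> j < n \<and> (\<exists>e \<in> {int k, - int k}. int n dvd int j - int i - e)"
    "U i \<rightarrow>\<^bsub>GP n k\<^esub> V j \<longleftrightarrow> i < n \<and> j = i"
    "V i \<rightarrow>\<^bsub>GP n k\<^esub> U j \<longleftrightarrow> i < n \<and> j = i"
proof -
  have flip: "int n dvd int i - int j - e \<longleftrightarrow> int n dvd int j - int i - (- e)" for e
    using dvd_minus_iff[of "int n" "int i - int j - e"] by (simp add: algebra_simps)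
  show "U i \<rightarrow>\<^bsub>GP n k\<^esub> U j \<longleftrightarrow>
      i < n \<and> j < n \<and> (\<exists>e \<in> {1, -1}. int n dvd int j - int i - e)"
    using eq_add_mod_iff[OF assms, of j i 1] eq_add_mod_iff[OF assms, of i j 1] flip[of 1]
    by (auto simp: arcs_ends_GP GP_edges_def)
  show "V i \<rightarrow>\<^bsub>GP n k\<^esub> V j \<longleftrightarrow>
      i < n \<and> j < n \<and> (\<exists>e \<in> {int k, - int k}. int n dvd int j - int i - e)"
    using eq_add_mod_iff[OF assms, of j i k] eq_add_mod_iff[OF assms, of i j k] flip[of "int k"]
    by (auto simp: arcs_ends_GP GP_edges_def)
qed (auto simp: arcs_ends_GP GP_edges_def)

lemma residue_nat:
  assumes "0 < n"
  obtains j where "j < n" "int n dvd int j - x"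
  using that[of "nat (x mod int n)"] assms by (simp add: mod_eq_dvd_iff[symmetric] nat_less_iff)

text \<open>The potential is \<open>gp_dist\<close> to the fixed vertex \<open>x\<close>. The step
  lemmas bound its change along edges, and the descent lemmas supply a closer neighbour for each
  combination of kinds.\<close>

lemma graph_dist_GP:
  assumes kn: "1 \<le> k" "2 * k < n" and w: "w \<in> verts (GP n k)" and x: "x \<in> verts (GP n k)"
  shows "int (graph_dist (GP n k) w x) = gp_dist (int n) (int k) w x"
proof -
  interpret graph "GP n k" using graph_GP[OF kn] .
  interpret circulant "int n" "int k" by unfold_locales (use kn in simp)
  have n0: "0 < n" using kn by simp
  note adj = GP_adj_iff[OF n0]
  have nonneg: "0 \<le> a i" "0 \<le> c i" for i
    using circ_norm_le_outer[of i] circ_norm_le_inner[of i] circ_norm_nonneg[of i] by linarith+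
  show ?thesis
  proof (rule graph_dist_eqI[OF x _ _ _ _ w])
    show "gp_dist (int n) (int k) x x = 0" by (cases x) auto
    show "0 \<le> gp_dist (int n) (int k) u x" for u
      by (cases u; cases x) (auto simp: nonneg intro: add_nonneg_nonneg)
  next
    fix u v assume uv: "u \<rightarrow>\<^bsub>GP n k\<^esub> v"
    \<comment> \<open>Adjacency concerns \<open>j - i\<close>, the step lemmas need
      \<open>i - j\<close>; the set of steps is closed under negation.\<close>
    have flip: "\<exists>e \<in> {z, -z}. int n dvd (int i - m) - (int j - m) - e"
      if "\<exists>e \<in> {z, -z}. int n dvd int j - int i - e" for i j m z
    proof -
      from that obtain e where e: "e \<in> {z, -z}" "int n dvd int j - int i - e" ..
      have "int n dvd - (int j - int i - e)" using e(2) by (simp only: dvd_minus_iff)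
      also have "- (int j - int i - e) = (int i - m) - (int j - m) - (- e)" by simp
      finally show ?thesis by (rule bexI) (use e(1) in auto)
    qed
    have UU: "f (int i - m) \<le> f (int j - m) + 1" "a (int i - m) \<le> a (int j - m) + 1"
      if "U i \<rightarrow>\<^bsub>GP n k\<^esub> U j" for i j m
    proof -
      have "\<exists>e \<in> {1, -1}. int n dvd int j - int i - e" using that by (simp only: adj)
      from flip[OF this] obtain e
        where e: "e \<in> {1, -1}" "int n dvd (int i - m) - (int j - m) - e" by blast
      from e show "a (int i - m) \<le> a (int j - m) + 1" by (intro outer_norm_step)
      from e show "f (int i - m) \<le> f (int j - m) + 1" by (intro circ_norm_step[of _ _ e]) auto
    qed
    have VV: "f (int i - m) \<le> f (int j - m) + 1" "c (int i - m) \<le> c (int j - m) + 1"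
      if "V i \<rightarrow>\<^bsub>GP n k\<^esub> V j" for i j m
    proof -
      have "\<exists>e \<in> {int k, - int k}. int n dvd int j - int i - e" using that by (simp only: adj)
      from flip[OF this] obtain e
        where e: "e \<in> {int k, - int k}" "int n dvd (int i - m) - (int j - m) - e" by blast
      from e show "c (int i - m) \<le> c (int j - m) + 1" by (intro inner_norm_step)
      from e show "f (int i - m) \<le> f (int j - m) + 1" by (intro circ_norm_step[of _ _ e]) auto
    qed
    note norm_le = outer_norm_le circ_norm_le_outer inner_norm_le circ_norm_le_inner
    show "gp_dist (int n) (int k) u x \<le> gp_dist (int n) (int k) v x + 1"
      using uv by (cases u; cases v; cases x) (auto simp: adj(3,4) norm_le norm_le[unfolded add.commute[of _ 2]]
          intro: UU VV UU[unfolded add.commute[of _ 1]] VV[unfolded add.commute[of _ 1]])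
  next
    fix u assume u: "u \<in> verts (GP n k)" "u \<noteq> x"
    have nbr: "\<exists>j < n. int n dvd int j - int i - e \<and> int n dvd (int j - m) - (int i - m + e)" for i e m
    proof -
      obtain j where j: "j < n" "int n dvd int j - (int i + e)"
        using residue_nat[OF n0] by blast
      then show ?thesis by (intro exI[of _ j]) (simp add: algebra_simps)
    qed
    \<comment> \<open>An arbitrary periodic \<open>g\<close> is allowed because the claim serves
      both \<open>a\<close>, for outer targets, and \<open>f\<close>, for inner ones.\<close>
    have UU: "\<exists>v. U i \<rightarrow>\<^bsub>GP n k\<^esub> U v \<and> g (int v - m) < g (int i - m)"
      if "i < n" and ex: "\<exists>e \<in> {1, -1}. g (int i - m + e) < g (int i - m)"
        and cong: "\<And>x y. int n dvd x - y \<Longrightarrow> g x = g y" for i m and g :: "int \<Rightarrow> int"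
    proof -
      obtain e where e: "e \<in> {1, -1}" "g (int i - m + e) < g (int i - m)" using ex by blast
      obtain j where j: "j < n" "int n dvd int j - int i - e" "int n dvd (int j - m) - (int i - m + e)"
        using nbr by blast
      show ?thesis using e j(1,2) \<open>i < n\<close> cong[OF j(3)] by (intro exI[of _ j]) (auto simp only: adj)
    qed
    have VV: "\<exists>v. V i \<rightarrow>\<^bsub>GP n k\<^esub> V v \<and> g (int v - m) < g (int i - m)"
      if "i < n" and ex: "\<exists>e \<in> {int k, - int k}. g (int i - m + e) < g (int i - m)"
        and cong: "\<And>x y. int n dvd x - y \<Longrightarrow> g x = g y" for i m and g :: "int \<Rightarrow> int"
    proof -
      obtain e where e: "e \<in> {int k, - int k}" "g (int i - m + e) < g (int i - m)" using ex by blast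
      obtain j where j: "j < n" "int n dvd int j - int i - e" "int n dvd (int j - m) - (int i - m + e)"
        using nbr by blast
      show ?thesis using e j(1,2) \<open>i < n\<close> cong[OF j(3)] by (intro exI[of _ j]) (auto simp only: adj)
    qed
    have ndvd: "\<not> int n dvd int i - int m" if "i < n" "m < n" "i \<noteq> m" for i m
      using that zdvd_imp_le[of "int n" "\<bar>int i - int m\<bar>"] by auto
    show "\<exists>v. u \<rightarrow>\<^bsub>GP n k\<^esub> v \<and> gp_dist (int n) (int k) v x < gp_dist (int n) (int k) u x"
    proof (cases u; cases x)
      fix i m assume [simp]: "u = U i" "x = U m"
      have "i < n" "m < n" "i \<noteq> m" using u x by auto
      from outer_norm_descend[OF ndvd[OF this]] show ?thesis
      proof
        assume "f (int i - int m) + 1 < a (int i - int m)"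
        then show ?thesis using \<open>i < n\<close> by (intro exI[of _ "V i"]) (simp add: adj)
      next
        assume "\<exists>e\<in>{1, - 1}. a (int i - int m + e) < a (int i - int m)"
        from UU[OF \<open>i < n\<close> this outer_norm_cong] show ?thesis by force
      qed
    next
      fix i m assume [simp]: "u = V i" "x = V m"
      have "i < n" "m < n" "i \<noteq> m" using u x by auto
      from inner_norm_descend[OF ndvd[OF this]] show ?thesis
      proof
        assume "f (int i - int m) + 1 < c (int i - int m)"
        then show ?thesis using \<open>i < n\<close> by (intro exI[of _ "U i"]) (simp add: adj)
      next
        assume "\<exists>e\<in>{int k, - int k}. c (int i - int m + e) < c (int i - int m)"
        from VV[OF \<open>i < n\<close> this inner_norm_cong] show ?thesis by force
      qed
    next
      fix i m assume [simp]: "u = U i" "x = V m"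
      have "i < n" using u by auto
      from spoke_descend_inner[of "int i - int m"] show ?thesis
      proof
        assume "c (int i - int m) < f (int i - int m) + 1"
        then show ?thesis using \<open>i < n\<close> by (intro exI[of _ "V i"]) (simp add: adj)
      next
        assume "\<exists>e\<in>{1, - 1}. f (int i - int m + e) < f (int i - int m)"
        from UU[OF \<open>i < n\<close> this circ_norm_cong] show ?thesis by force
      qed
    next
      fix i m assume [simp]: "u = V i" "x = U m"
      have "i < n" using u by auto
      from spoke_descend_outer[of "int i - int m"] show ?thesis
      proof
        assume "a (int i - int m) < f (int i - int m) + 1"
        then show ?thesis using \<open>i < n\<close> by (intro exI[of _ "U i"]) (simp add: adj)
      next
        assume "\<exists>e\<in>{int k, - int k}. f (int i - int m + e) < f (int i - int m)"
        from VV[OF \<open>i < n\<close> this circ_norm_cong] show ?thesis by force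
      qed
    qed
  qed
qed

section \<open>Balance as a sum of signs, and the reduction to two index differences\<close>

text \<open>The difference \<open>|W\<^sub>v\<^sub>u| - |W\<^sub>u\<^sub>v|\<close> for \<open>u = u\<^sub>0\<close> and \<open>v = v\<^sub>d\<close>, whatever their distance.\<close>

definition spoke_balance :: "int \<Rightarrow> int \<Rightarrow> int \<Rightarrow> int" where
  "spoke_balance n k d = (\<Sum>j\<in>{0..<n}.
     sgn (outer_norm n k j - circ_norm n k (j - d) - 1) +
     sgn (circ_norm n k j + 1 - inner_norm n k (j - d)))"

text \<open>Reduction modulo \<open>n\<close> maps any \<open>n\<close> consecutive integers
  bijectively onto the residues.\<close>

lemma sum_residues:
  fixes n p :: int and F :: "int \<Rightarrow> int"
  assumes "0 < n" and per: "\<And>x y. n dvd x - y \<Longrightarrow> F x = F y"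
  shows "(\<Sum>j\<in>{p..<p + n}. F j) = (\<Sum>j\<in>{0..<n}. F j)"
proof -
  have inj: "inj_on (\<lambda>x. x mod n) {p..<p + n}"
  proof (rule inj_onI)
    fix x y assume xy: "x \<in> {p..<p + n}" "y \<in> {p..<p + n}" "x mod n = y mod n"
    then have "n dvd \<bar>x - y\<bar>" by (simp add: mod_eq_dvd_iff)
    then show "x = y" using xy zdvd_imp_le[of n "\<bar>x - y\<bar>"] by (cases "x = y") auto
  qed
  have "(\<lambda>x. x mod n) ` {p..<p + n} = {0..<n}"
    using assms(1) card_image[OF inj] by (intro card_subset_eq) auto
  with inj have "bij_betw (\<lambda>x. x mod n) {p..<p + n} {0..<n}" by (simp add: bij_betw_def)
  from sum.reindex_bij_betw[OF this, of F]
  have "(\<Sum>x\<in>{p..<p + n}. F (x mod n)) = (\<Sum>x\<in>{0..<n}. F x)" .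
  moreover have "F (x mod n) = F x" for x by (rule per) (simp add: mod_eq_dvd_iff[symmetric])
  ultimately show ?thesis by simp
qed


lemma sum_residues_int:
  fixes F :: "int \<Rightarrow> int"
  assumes "0 < n" and per: "\<And>x y. int n dvd x - y \<Longrightarrow> F x = F y"
  shows "(\<Sum>i<n. F (int i - m)) = (\<Sum>j\<in>{0..<int n}. F j)"
proof -
  have "bij_betw (\<lambda>i. int i - m) {..<n} {-m..<-m + int n}"
    by (rule bij_betw_byWitness[where f' = "\<lambda>j. nat (j + m)"]) auto
  from sum.reindex_bij_betw[OF this, of F] sum_residues[of "int n" F "-m"] assms
  show ?thesis by simp
qed

lemma sum_residues_reflect:
  fixes F :: "int \<Rightarrow> int"
  assumes "0 < n" and per: "\<And>x y. n dvd x - y \<Longrightarrow> F x = F y"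
  shows "(\<Sum>j\<in>{0..<n}. F (d - j)) = (\<Sum>j\<in>{0..<n}. F j)"
proof -
  have "bij_betw (\<lambda>j. d - j) {0..<n} {d - n + 1..<d - n + 1 + n}"
    by (rule bij_betw_byWitness[where f' = "\<lambda>j. d - j"]) auto
  from sum.reindex_bij_betw[OF this, of F] sum_residues[of n F "d - n + 1"] assms
  show ?thesis by simp
qed

lemma sum_sgn_eq_card_diff:
  fixes p q :: "'a \<Rightarrow> int"
  assumes "finite A"
  shows "(\<Sum>w\<in>A. sgn (q w - p w)) = int (card {w \<in> A. p w < q w}) - int (card {w \<in> A. q w < p w})"
proof -
  have "sgn (q w - p w) = (if p w < q w then 1 else 0) - (if q w < p w then 1 else 0)" for w
    by (simp add: sgn_if)
  then show ?thesis using assms by (simp add: sum_subtractf sum.inter_filter[symmetric])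
qed

text \<open>Encodes |W_xy| - |W_yx|. Unlike the two cardinalities, a sum of signs can be split by
  kind of vertex, reindexed and estimated term by term.\<close>

definition pair_balance :: "int \<Rightarrow> int \<Rightarrow> gp_vertex set \<Rightarrow> gp_vertex \<Rightarrow> gp_vertex \<Rightarrow> int" where
  "pair_balance n k W x y = (\<Sum>w\<in>W. sgn (gp_dist n k w y - gp_dist n k w x))"

lemma distance_balanced_GP_iff:
  assumes kn: "1 \<le> k" "2 * k < n"
  shows "distance_balanced 2 (GP n k) \<longleftrightarrow>
    (\<forall>x \<in> verts (GP n k). \<forall>y \<in> verts (GP n k). gp_dist (int n) (int k) x y = 2 \<longrightarrow>
       pair_balance (int n) (int k) (verts (GP n k)) x y = 0)"
proof -
  interpret graph "GP n k" using graph_GP[OF kn] .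
  have closer: "closer_verts (GP n k) x y =
      {w \<in> verts (GP n k). gp_dist (int n) (int k) w x < gp_dist (int n) (int k) w y}"
    if "x \<in> verts (GP n k)" "y \<in> verts (GP n k)" for x y
    using that by (auto simp: closer_verts_def simp flip: graph_dist_GP[OF kn])
  have "card (closer_verts (GP n k) x y) = card (closer_verts (GP n k) y x) \<longleftrightarrow>
      pair_balance (int n) (int k) (verts (GP n k)) x y = 0"
    if "x \<in> verts (GP n k)" "y \<in> verts (GP n k)" for x y
    using that by (simp add: closer pair_balance_def sum_sgn_eq_card_diff)
  moreover have "graph_dist (GP n k) x y = 2 \<longleftrightarrow> gp_dist (int n) (int k) x y = 2"
    if "x \<in> verts (GP n k)" "y \<in> verts (GP n k)" for x y
    using graph_dist_GP[OF kn that] by linarith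
  ultimately show ?thesis
    using graph_GP[OF kn] connected_GP[OF kn] graph_diameter_GP[OF kn]
    by (auto simp: distance_balanced_def)
qed

lemma sum_GP_verts:
  fixes F :: "gp_vertex \<Rightarrow> int"
  shows "(\<Sum>w\<in>verts (GP n k). F w) = (\<Sum>i<n. F (U i)) + (\<Sum>i<n. F (V i))"
proof -
  have "(\<Sum>w\<in>verts (GP n k). F w) = sum F (U ` {..<n}) + sum F (V ` {..<n})"
    unfolding GP_def GP_verts_def by (simp, intro sum.union_disjoint) auto
  then show ?thesis by (simp add: sum.reindex inj_on_def)
qed

text \<open>The reflection \<open>j\<close> to \<open>d - j\<close> exchanges the two arguments of
  the difference, so the sum equals its own negative.\<close>

lemma (in circulant) reflection_balance:
  assumes cong: "\<And>x y. n dvd x - y \<Longrightarrow> g x = g y" and even: "\<And>x. g (- x) = g x"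
  shows "(\<Sum>j\<in>{0..<n}. sgn (g (j - d) - g j)) = (0::int)"
proof -
  have "(\<Sum>j\<in>{0..<n}. sgn (g (j - d) - g j)) = (\<Sum>j\<in>{0..<n}. sgn (g ((d - j) - d) - g (d - j)))"
    by (rule sum_residues_reflect[symmetric, OF n_pos, of "\<lambda>j. sgn (g (j - d) - g j)"])
      (intro arg_cong[where f = sgn] arg_cong2[where f = "(-)"] cong; simp)
  also have "\<dots> = (\<Sum>j\<in>{0..<n}. - sgn (g (j - d) - g j))"
  proof (intro sum.cong refl)
    fix j
    have "g ((d - j) - d) = g j" using even[of j] by simp
    moreover have "g (d - j) = g (j - d)" using even[of "j - d"] by simp
    ultimately show "sgn (g ((d - j) - d) - g (d - j)) = - sgn (g (j - d) - g j)"
      by (simp add: sgn_if)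
  qed
  finally show ?thesis by (simp add: sum_negf)
qed

lemma pair_balance_GP:
  assumes "0 < n"
  shows "pair_balance (int n) (int k) (verts (GP n k)) (U i) (U j) = 0"
    and "pair_balance (int n) (int k) (verts (GP n k)) (V i) (V j) = 0"
    and "pair_balance (int n) (int k) (verts (GP n k)) (U i) (V j) =
      - spoke_balance (int n) (int k) (int j - int i)"
    and "pair_balance (int n) (int k) (verts (GP n k)) (V j) (U i) =
      spoke_balance (int n) (int k) (int j - int i)"
proof -
  interpret circulant "int n" "int k" by unfold_locales (use assms in simp)
  have dvd_shift: "int n dvd (x - d) - (y - d)" if "int n dvd x - y" for x y d using that by simp
  \<comment> \<open>Periodicity allows recentring at \<open>q\<close>. The offset \<open>e\<close>
    accounts for the spoke in a pair of different kinds.\<close>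
  have shift: "(\<Sum>l<n. sgn (g (int l - int p) - h (int l - int q) + e)) =
      (\<Sum>l\<in>{0..<int n}. sgn (g (l - (int p - int q)) - h l + e))"
    if "\<And>x y. int n dvd x - y \<Longrightarrow> g x = g y" "\<And>x y. int n dvd x - y \<Longrightarrow> h x = h y"
    for g h :: "int \<Rightarrow> int" and p q e
  proof -
    have per: "sgn (g (x - (int p - int q)) - h x + e) = sgn (g (y - (int p - int q)) - h y + e)"
      if "int n dvd x - y" for x y
      using that \<open>\<And>x y. int n dvd x - y \<Longrightarrow> g x = g y\<close>[of "x - (int p - int q)" "y - (int p - int q)"]
        \<open>\<And>x y. int n dvd x - y \<Longrightarrow> h x = h y\<close>[of x y] by simp
    show ?thesis
      using sum_residues_int[OF assms, of "\<lambda>l. sgn (g (l - (int p - int q)) - h l + e)" "int q", OF per]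
      by (simp add: algebra_simps)
  qed
  note shift0 = shift[where e = 0, simplified]
  have sgn_flip: "sgn (x - y) = - sgn (y - x)" for x y :: int by (simp add: sgn_if)
  show "pair_balance (int n) (int k) (verts (GP n k)) (U i) (U j) = 0"
    unfolding pair_balance_def sum_GP_verts
    by (simp add: shift0 outer_norm_cong circ_norm_cong reflection_balance outer_norm_minus circ_norm_minus)
  show "pair_balance (int n) (int k) (verts (GP n k)) (V i) (V j) = 0"
    unfolding pair_balance_def sum_GP_verts
    by (simp add: shift0 inner_norm_cong circ_norm_cong reflection_balance inner_norm_minus circ_norm_minus)
  show *: "pair_balance (int n) (int k) (verts (GP n k)) (U i) (V j) =
      - spoke_balance (int n) (int k) (int j - int i)"
  proof -
    have "(\<Sum>l<n. sgn (f (int l - int j) - a (int l - int i) + 1)) =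
        (\<Sum>l\<in>{0..<int n}. - sgn (a l - f (l - (int j - int i)) - 1))"
      by (subst shift) (auto intro: outer_norm_cong circ_norm_cong intro!: sum.cong simp: sgn_if)
    moreover have "(\<Sum>l<n. sgn (c (int l - int j) - f (int l - int i) + (-1))) =
        (\<Sum>l\<in>{0..<int n}. - sgn (f l + 1 - c (l - (int j - int i))))"
      by (subst shift) (auto intro: inner_norm_cong circ_norm_cong intro!: sum.cong simp: sgn_if)
    ultimately show ?thesis
      unfolding pair_balance_def sum_GP_verts spoke_balance_def
      by (simp add: sum.distrib sum_negf algebra_simps)
  qed
  have "pair_balance (int n) (int k) (verts (GP n k)) (V j) (U i) =
      - pair_balance (int n) (int k) (verts (GP n k)) (U i) (V j)"
    unfolding pair_balance_def sum_negf[symmetric] by (intro sum.cong refl sgn_flip)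
  with * show "pair_balance (int n) (int k) (verts (GP n k)) (V j) (U i) =
      spoke_balance (int n) (int k) (int j - int i)" by simp
qed

text \<open>Pairs of the same kind are always balanced, and vertices of different kinds have
  distance 2 exactly when their index difference has circulant norm 1.\<close>

lemma distance_balanced_GP_iff_all_spoke_balance:
  assumes kn: "1 \<le> k" "2 * k < n"
  shows "distance_balanced 2 (GP n k) \<longleftrightarrow>
    (\<forall>d. circ_norm (int n) (int k) d = 1 \<longrightarrow> spoke_balance (int n) (int k) d = 0)"
proof -
  interpret circulant "int n" "int k" by unfold_locales (use kn in simp)
  have n0: "0 < n" using kn by simp
  note bal = pair_balance_GP[OF n0]
  have sym: "f (int i - int j) = f (int j - int i)" for i j
    using circ_norm_minus[of "int i - int j"] by simp
  have "spoke_balance (int n) (int k) d = 0"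
    if *: "\<forall>i<n. \<forall>j<n. f (int i - int j) = 1 \<longrightarrow> spoke_balance (int n) (int k) (int j - int i) = 0"
      and d: "f d = 1" for d
  proof -
    obtain j where j: "j < n" "int n dvd int j - d" using residue_nat[OF n0] by blast
    have "f (int 0 - int j) = 1" using circ_norm_cong[OF j(2)] d sym[of 0 j] by simp
    then have "spoke_balance (int n) (int k) (int j) = 0" using * j(1) n0 by force
    moreover have "int n dvd (x - int j) - (x - d)" for x
      using j(2) dvd_minus_iff[of "int n" "int j - d"] by simp
    ultimately show ?thesis
      unfolding spoke_balance_def using circ_norm_cong inner_norm_cong by (smt (verit) sum.cong)
  qed
  moreover have "(\<forall>x \<in> verts (GP n k). \<forall>y \<in> verts (GP n k). gp_dist (int n) (int k) x y = 2 \<longrightarrow>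
       pair_balance (int n) (int k) (verts (GP n k)) x y = 0) \<longleftrightarrow>
    (\<forall>i<n. \<forall>j<n. f (int i - int j) = 1 \<longrightarrow> spoke_balance (int n) (int k) (int j - int i) = 0)"
  proof -
    have ball: "(\<forall>x \<in> verts (GP n k). P x) \<longleftrightarrow> (\<forall>i<n. P (U i) \<and> P (V i))" for P
      by (auto simp: GP_def GP_verts_def)
    show ?thesis unfolding ball using sym by (auto simp: bal)
  qed
  ultimately show ?thesis
    unfolding distance_balanced_GP_iff[OF kn] using sym by fastforce
qed

lemma (in circulant) spoke_balance_cong:
  assumes "n dvd d - d'"
  shows "spoke_balance n k d = spoke_balance n k d'"
proof -
  have "n dvd (j - d) - (j - d')" for j
    using assms dvd_minus_iff[of n "d - d'"] by simp
  then show ?thesis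
    unfolding spoke_balance_def
    by (metis (no_types, lifting) circ_norm_cong inner_norm_cong)
qed

lemma (in circulant) spoke_balance_minus: "spoke_balance n k (- d) = spoke_balance n k d"
proof -
  let ?F = "\<lambda>j. sgn (a j - f (j - d) - 1) + sgn (f j + 1 - c (j - d))"
  have per: "?F x = ?F y" if "n dvd x - y" for x y
    using outer_norm_cong[OF that] circ_norm_cong[OF that]
      circ_norm_cong[of "x - d" "y - d"] inner_norm_cong[of "x - d" "y - d"] that by simp
  have "?F (0 - j) = sgn (a j - f (j + d) - 1) + sgn (f j + 1 - c (j + d))" for j
    using outer_norm_minus[of j] circ_norm_minus[of j] circ_norm_minus[of "j + d"]
      inner_norm_minus[of "j + d"] by simp
  with sum_residues_reflect[of n ?F 0, OF n_pos per] show ?thesis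
    unfolding spoke_balance_def by simp
qed

text \<open>A representation of cost 1 is a single step. Conversely, norm 0 would force
  \<open>n\<close> to divide that step, although \<open>k < n\<close>.\<close>

lemma (in circulant) circ_norm_eq_1_iff:
  assumes "0 < k" "2 * k < n"
  shows "f d = 1 \<longleftrightarrow> (\<exists>e \<in> {1, -1, k, -k}. n dvd d - e)"
proof
  assume "f d = 1"
  then obtain s t where st: "n dvd d - s - t * k" "\<bar>s\<bar> + \<bar>t\<bar> = 1"
    using circ_norm_attained[of d] by metis
  then have "(s = 1 \<or> s = -1) \<and> t = 0 \<or> s = 0 \<and> (t = 1 \<or> t = -1)" by linarith
  with st(1) show "\<exists>e \<in> {1, -1, k, -k}. n dvd d - e" by auto
next
  assume "\<exists>e \<in> {1, -1, k, -k}. n dvd d - e"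
  then obtain e where e: "e \<in> {1, -1, k, -k}" "n dvd d - e" by blast
  have "f d \<le> 1" using circ_norm_step[of d 0 e] e by simp
  moreover have "f d \<noteq> 0"
  proof
    assume "f d = 0"
    then obtain s t where "n dvd d - s - t * k" "\<bar>s\<bar> + \<bar>t\<bar> = 0"
      using circ_norm_attained[of d] by metis
    then have "n dvd d" by (cases "s = 0"; cases "t = 0") auto
    then have "n dvd e" using e(2) dvd_diff[of n d "d - e"] by simp
    then show False using e(1) assms zdvd_imp_le[of n "\<bar>e\<bar>"] by auto
  qed
  ultimately show "f d = 1" using circ_norm_nonneg[of d] by linarith
qed

text \<open>Negating all indices is a symmetry, so one sign of each of the differences 1 and
  \<open>k\<close> suffices.\<close>

lemma distance_balanced_GP_iff_spoke_balance:
  assumes kn: "1 \<le> k" "2 * k < n"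
  shows "distance_balanced 2 (GP n k) \<longleftrightarrow>
    spoke_balance (int n) (int k) 1 = 0 \<and> spoke_balance (int n) (int k) (int k) = 0"
proof -
  interpret circulant "int n" "int k" by unfold_locales (use kn in simp)
  have "(\<forall>d. f d = 1 \<longrightarrow> spoke_balance (int n) (int k) d = 0) \<longleftrightarrow>
      (\<forall>e \<in> {1, -1, int k, - int k}. spoke_balance (int n) (int k) e = 0)"
    (is "?L \<longleftrightarrow> ?R")
  proof -
    have iff: "f d = 1 \<longleftrightarrow> (\<exists>e \<in> {1, -1, int k, - int k}. int n dvd d - e)" for d
      by (rule circ_norm_eq_1_iff) (use kn in simp_all)
    show ?thesis
    proof
      assume L: ?L
      show ?R
      proof
        fix e assume e: "e \<in> {1, -1, int k, - int k}"
        have "int n dvd e - e" by simp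
        with e iff have "f e = 1" by blast
        with L show "spoke_balance (int n) (int k) e = 0" by blast
      qed
    next
      assume R: ?R
      show ?L
      proof (intro allI impI)
        fix d assume "f d = 1"
        with iff obtain e where e: "e \<in> {1, -1, int k, - int k}" "int n dvd d - e" by blast
        from R e(1) have "spoke_balance (int n) (int k) e = 0" by blast
        with spoke_balance_cong[OF e(2)] show "spoke_balance (int n) (int k) d = 0" by simp
      qed
    qed
  qed
  then show ?thesis
    by (simp add: distance_balanced_GP_iff_all_spoke_balance[OF kn] spoke_balance_minus)
qed

section \<open>Lower bound for the balance at difference 1\<close>

context circulant
begin

text \<open>A representation cheaper than \<open>i\<close> either uses steps by \<open>k\<close>
  without wrapping, at cost at least \<open>k - i + 1\<close>, or wraps around modulo
  \<open>n\<close>. Wrapping needs \<open>n\<close> to be at most \<open>i + (i - 1) * k\<close>,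
  hence at most \<open>(k * k + 1) / 2\<close>.\<close>

lemma circ_norm_small:
  assumes "0 < k" "k * k + 1 < 2 * n" "0 \<le> i" "2 * i \<le> k + 1"
  shows "f i = i"
proof -
  obtain s t where st: "n dvd i - s - t * k" "f i = \<bar>s\<bar> + \<bar>t\<bar>"
    using circ_norm_attained[of i] by blast
  have "f i \<le> i" using circ_norm_le[of i i 0] assms by simp
  moreover have "\<not> f i < i"
  proof
    assume lt: "f i < i"
    obtain q where q: "i - s - t * k = n * q" using st(1) by (auto elim: dvdE)
    show False
    proof (cases "q = 0")
      case True
      then have s: "s = i - t * k" using q by simp
      have "t \<noteq> 0" using s lt st(2) by auto
      then consider "1 \<le> t" | "t \<le> -1" by linarith
      then have "t * k \<ge> k \<or> t * k \<le> - k"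
        using assms(1) mult_right_mono[of 1 t k] mult_right_mono[of t "-1" k] by cases auto
      then have "\<bar>s\<bar> \<ge> k - i" using s assms by linarith
      then show False using lt st(2) \<open>t \<noteq> 0\<close> assms by linarith
    next
      case False
      then have "n \<le> \<bar>n * q\<bar>" using n_pos by (simp add: abs_mult)
      also have "\<dots> = \<bar>i - s - t * k\<bar>" using q by simp
      also have "\<dots> \<le> i + \<bar>s\<bar> + \<bar>t * k\<bar>" using assms by linarith
      also have "\<dots> \<le> i + (\<bar>s\<bar> + \<bar>t\<bar>) * k"
        using assms(1) mult_left_mono[of 1 k "\<bar>s\<bar>"] by (simp add: abs_mult algebra_simps)
      also have "\<dots> \<le> i + (i - 1) * k"
        using assms(1) lt st(2) by (intro add_left_mono mult_right_mono) auto
      finally have "2 * n \<le> 2 * i + (2 * i - 2) * k" by (simp add: algebra_simps)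
      also have "\<dots> \<le> (k + 1) + (k - 1) * k"
        using assms by (intro add_mono mult_right_mono) auto
      also have "\<dots> = k * k + 1" by (simp add: algebra_simps)
      finally show False using assms(2) by simp
    qed
  qed
  ultimately show ?thesis by linarith
qed

text \<open>A representation of cost below \<bar>t\<bar> stays within (\<bar>t\<bar> - 1) * k of 0,
  so it misses \<open>t * k\<close> itself, and the difference is too small for a multiple of
  \<open>n\<close>.\<close>

lemma norms_multiple:
  assumes "0 < k" "(2 * \<bar>t\<bar> - 1) * k < n"
  shows "f (t * k) = \<bar>t\<bar>" "c (t * k) = \<bar>t\<bar>"
proof -
  have "c (t * k) \<le> \<bar>t\<bar>" by (rule inner_norm_le_abs) simp
  moreover have "f (t * k) \<le> c (t * k)" by (rule circ_norm_le_inner)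
  moreover have "\<not> f (t * k) < \<bar>t\<bar>"
  proof
    assume lt: "f (t * k) < \<bar>t\<bar>"
    obtain s t' where st: "n dvd t * k - s - t' * k" "f (t * k) = \<bar>s\<bar> + \<bar>t'\<bar>"
      using circ_norm_attained[of "t * k"] by blast
    obtain q where q: "t * k - s - t' * k = n * q" using st(1) by (auto elim: dvdE)
    have "\<bar>s + t' * k\<bar> \<le> \<bar>s\<bar> + \<bar>t' * k\<bar>" by linarith
    also have "\<dots> \<le> (\<bar>s\<bar> + \<bar>t'\<bar>) * k"
      using assms(1) mult_left_mono[of 1 k "\<bar>s\<bar>"] by (simp add: abs_mult algebra_simps)
    also have "\<dots> \<le> (\<bar>t\<bar> - 1) * k"
      using assms(1) lt st(2) by (intro mult_right_mono) auto
    finally have *: "\<bar>s + t' * k\<bar> \<le> \<bar>t * k\<bar> - k" using assms(1) by (simp add: abs_mult algebra_simps)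
    show False
    proof (cases "q = 0")
      case True
      then have "t * k = s + t' * k" using q by simp
      then show False using * assms(1) by simp
    next
      case False
      then have "n \<le> \<bar>n * q\<bar>" using n_pos by (simp add: abs_mult)
      also have "\<dots> \<le> \<bar>t * k\<bar> + \<bar>s + t' * k\<bar>" unfolding q[symmetric] by linarith
      also have "\<dots> \<le> 2 * \<bar>t * k\<bar> - k" using * by linarith
      also have "\<dots> = (2 * \<bar>t\<bar> - 1) * k" using assms(1) by (simp add: abs_mult algebra_simps)
      finally show False using assms(2) by simp
    qed
  qed
  ultimately show "f (t * k) = \<bar>t\<bar>" "c (t * k) = \<bar>t\<bar>" by linarith+
qed

text \<open>The bound \<open>c (j - 1) \<le> f (j - 1) + 2\<close> gives the generic sign. At
  \<open>j = 1 + t * k\<close> one has \<open>c (j - 1) = f (j - 1)\<close> instead, which raises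
  the sign by at least 1 because \<open>f\<close> changes by at most 1 per index.\<close>

lemma inner_gain:
  assumes "0 < k" "(2 * T - 1) * k < n"
  shows "(\<Sum>j\<in>{0..<n}. sgn (f j + 1 - c (j - 1))) \<ge> (\<Sum>j\<in>{0..<n}. sgn (f j - f (j - 1) - 1)) + 2 * T"
proof -
  \<comment> \<open>Leaving out \<open>t = -T\<close> keeps the differences of two values of
    \<open>t\<close> at most \<open>2 * T - 1\<close>, so the hypothesis also yields injectivity
    modulo \<open>n\<close>.\<close>
  define G where "G = (\<lambda>t. (1 + t * k) mod n) ` {1 - T..T}"
  have "inj_on (\<lambda>t. (1 + t * k) mod n) {1 - T..T}"
  proof (rule inj_onI)
    fix t t' assume t: "t \<in> {1 - T..T}" "t' \<in> {1 - T..T}" "(1 + t * k) mod n = (1 + t' * k) mod n"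
    then have "n dvd \<bar>(t - t') * k\<bar>" by (simp add: mod_eq_dvd_iff algebra_simps)
    moreover have "\<bar>(t - t') * k\<bar> \<le> (2 * T - 1) * k"
      using t assms(1) by (auto simp: abs_mult intro!: mult_right_mono)
    ultimately have "\<not> 0 < \<bar>(t - t') * k\<bar>" using zdvd_imp_le[of n "\<bar>(t - t') * k\<bar>"] assms(2) by linarith
    then show "t = t'" using assms(1) by simp
  qed
  then have card: "int (card G) = int (card {1 - T..T})" by (simp add: G_def card_image)
  have sub: "G \<subseteq> {0..<n}" using n_pos by (auto simp: G_def)
  have "sgn (f j - f (j - 1) - 1) + (if j \<in> G then 1 else 0) \<le> sgn (f j + 1 - c (j - 1))" for j
  proof (cases "j \<in> G")
    case True
    then obtain t where t: "t \<in> {1 - T..T}" "j = (1 + t * k) mod n" by (auto simp: G_def)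
    then have "n dvd j - (1 + t * k)" by (simp add: mod_eq_dvd_iff[symmetric])
    then have dvd: "n dvd (j - 1) - t * k" by (simp add: algebra_simps)
    have "(2 * \<bar>t\<bar> - 1) * k \<le> (2 * T - 1) * k" using t assms(1) by (intro mult_right_mono) auto
    also note assms(2)
    finally have "c (j - 1) = f (j - 1)"
      using norms_multiple[of t] circ_norm_cong[OF dvd] inner_norm_cong[OF dvd] assms(1) by metis
    then show ?thesis using circ_norm_diff_le[of j] True by (auto simp: sgn_if)
  next
    case False
    then show ?thesis using inner_norm_le[of "j - 1"] by (auto simp: sgn_if)
  qed
  then have "(\<Sum>j\<in>{0..<n}. sgn (f j - f (j - 1) - 1) + (if j \<in> G then 1 else 0)) \<le>
      (\<Sum>j\<in>{0..<n}. sgn (f j + 1 - c (j - 1)))" by (rule sum_mono)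
  moreover have "(\<Sum>j\<in>{0..<n}. (if j \<in> G then 1 else 0)) = int (card G)"
    using sub by (simp add: sum.If_cases Int_absorb1)
  ultimately show ?thesis using card by (simp add: sum.distrib split: if_splits)
qed

text \<open>The generic value \<open>a j = f j + 2\<close> fails only if walking along the outer
  cycle costs at most \<open>f j + 1\<close>. Comparison with one step by \<open>k\<close> shows
  that this harms the sign only up to \<open>k div 2 + 1\<close>, and by at most 1.\<close>

lemma outer_loss_pos:
  assumes "2 \<le> k" "1 \<le> j" "2 * j \<le> n"
  shows "sgn (f j - f (j - 1) + 1) - (if j \<le> k div 2 + 1 then 1 else 0) \<le> sgn (a j - f (j - 1) - 1)"
proof -
  have a: "a j = min j (f j + 2)" using assms cyc_norm_eq_abs[OF n_pos, of j] by (simp add: outer_norm_def)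
  have le: "f j \<le> j" "f (j - 1) \<le> j - 1" "f j \<le> \<bar>j - k\<bar> + 1" "f (j - 1) \<le> \<bar>j - 1 - k\<bar> + 1"
    using circ_norm_le[of j j 0] circ_norm_le[of "j - 1" "j - 1" 0]
      circ_norm_le[of j "j - k" 1] circ_norm_le[of "j - 1" "j - 1 - k" 1] assms by simp_all
  consider "f j + 2 \<le> j" | "j = f j + 1" | "j = f j" using le(1) by linarith
  then show ?thesis
  proof cases
    case 1
    then show ?thesis using a by (simp add: sgn_if)
  next
    case 2
    have "j \<le> k div 2 + 1 \<or> f (j - 1) < f j" using 2 le assms(1) by linarith
    then show ?thesis using a 2 by (auto simp: sgn_if)
  next
    case 3
    have "j \<le> k div 2 + 1" using 3 le assms(1) circ_norm_diff_le[of j] by linarith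
    then show ?thesis using a 3 le by (auto simp: sgn_if)
  qed
qed

text \<open>For \<open>k = 2\<close> the shortcut along the outer cycle reaches two indices further than in general.\<close>

lemma outer_loss_nonpos:
  assumes "2 \<le> k" "k * k + 1 < 2 * n" "0 \<le> i" "2 * i \<le> n"
  shows "sgn (f (- i) - f (- i - 1) + 1)
      - (if i \<le> (if k = 2 then 3 else (k + 1) div 2) then 1 else 0)
      - (if even k \<and> i = k div 2 then 1 else 0) \<le> sgn (a (- i) - f (- i - 1) - 1)"
proof -
  have a: "a (- i) = min i (f i + 2)"
    using assms cyc_norm_eq_abs[OF n_pos, of "- i"] by (simp add: outer_norm_def circ_norm_minus)
  have f: "f (- i) = f i" "f (- i - 1) = f (i + 1)"
    using circ_norm_minus[of i] circ_norm_minus[of "i + 1"] by simp_all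
  have le: "f i \<le> i" "f i \<le> \<bar>i - k\<bar> + 1" "f (i + 1) \<le> \<bar>i + 1 - k\<bar> + 1" "f i \<le> \<bar>i - 2 * k\<bar> + 2"
    using circ_norm_le[of i i 0] circ_norm_le[of i "i - k" 1] circ_norm_le[of "i + 1" "i + 1 - k" 1]
      circ_norm_le[of i "i - 2 * k" 2] assms by simp_all
  have small: "f i = i" if "2 * i \<le> k + 1" using circ_norm_small that assms by simp
  have small1: "f (i + 1) = i + 1" if "2 * (i + 1) \<le> k + 1"
    using circ_norm_small[of "i + 1"] that assms by simp
  have diff: "\<bar>f (i + 1) - f i\<bar> \<le> 1" using circ_norm_diff_le[of "i + 1"] by simp
  consider "f i + 2 \<le> i" | "i = f i + 1" | "i = f i" using le(1) by linarith
  then show ?thesis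
  proof cases
    case 1
    then show ?thesis using a f by (simp add: sgn_if)
  next
    case 2
    \<comment> \<open>For \<open>k = 2\<close> and \<open>i\<close> at least 2, the bound through a
      single step by \<open>k\<close> gives nothing; the one through \<open>2 * k\<close> yields
      \<open>i \<le> 3\<close>.\<close>
    have "i \<le> (if k = 2 then 3 else (k + 1) div 2) \<or> f (i + 1) < f i"
      using 2 le assms(1) by (cases "k = 2") (simp_all, linarith+)
    then show ?thesis using a f 2 by (auto simp: sgn_if)
  next
    case 3
    have i: "2 * i \<le> k + 1" using 3 le(2,4) assms(1) by linarith
    then have "i \<le> (if k = 2 then 3 else (k + 1) div 2)" by auto
    \<comment> \<open>A loss of 2 requires \<open>f (i + 1) = f i = i\<close>. The first and last
      alternatives exclude this, leaving only \<open>i = k div 2\<close> with \<open>k\<close>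
      even.\<close>
    moreover have "2 * (i + 1) \<le> k + 1 \<or> (even k \<and> i = k div 2) \<or> f (i + 1) < i"
    proof (cases "2 * i = k + 1")
      case True
      then have "3 \<le> k" using assms(1) by presburger
      then have "f (i + 1) < i" using True le(3) by linarith
      then show ?thesis by simp
    next
      case False
      then show ?thesis using i by presburger
    qed
    ultimately show ?thesis using a f 3 small1 diff by (auto simp: sgn_if)
  qed
qed

lemma outer_loss:
  assumes "2 \<le> k" "k * k + 1 < 2 * n"
  shows "(\<Sum>j\<in>{0..<n}. sgn (a j - f (j - 1) - 1)) \<ge> (\<Sum>j\<in>{0..<n}. sgn (f j - f (j - 1) + 1)) -
    (2 * (k div 2) + (if k = 2 then 5 else 3))"
proof -
  \<comment> \<open>The window of \<open>n\<close> consecutive indices is centred at 0, so that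
    \<open>cyc_norm\<close> is the absolute value on it.\<close>
  define p where "p = - ((n - 1) div 2)"
  define lo where "lo = (if k = 2 then 3 else (k + 1) div 2)"
  let ?I = "{p..<p + n}"
  let ?loss = "\<lambda>j. (if j \<in> {- lo..k div 2 + 1} then 1 else 0) + (if even k \<and> j = - (k div 2) then 1 else (0 :: int))"
  have shift: "n dvd (x - 1) - (y - 1)" if "n dvd x - y" for x y using that by simp
  have "sgn (f j - f (j - 1) + 1) - ?loss j \<le> sgn (a j - f (j - 1) - 1)" if "j \<in> ?I" for j
  proof (cases "1 \<le> j")
    case True
    have "2 * j \<le> n" using that by (auto simp: p_def)
    from outer_loss_pos[OF assms(1) True this] show ?thesis using True assms(1) by (auto simp: lo_def)
  next
    case False
    obtain i where j: "j = - i" by (metis minus_minus)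
    have i: "0 \<le> i" "2 * i \<le> n" using that n_pos False by (auto simp: p_def j)
    have "i \<le> lo \<longleftrightarrow> - i \<in> {- lo..k div 2 + 1}" using i assms(1) by auto
    then show ?thesis
      using outer_loss_nonpos[OF assms i] unfolding j lo_def[symmetric] by simp
  qed
  then have "(\<Sum>j\<in>?I. sgn (f j - f (j - 1) + 1) - ?loss j) \<le> (\<Sum>j\<in>?I. sgn (a j - f (j - 1) - 1))"
    by (rule sum_mono)
  moreover have "(\<Sum>j\<in>?I. ?loss j) \<le> (lo + k div 2 + 2) + (if even k then 1 else 0)"
  proof -
    have "(\<Sum>j\<in>?I. if j \<in> {- lo..k div 2 + 1} then 1 else (0 :: int)) = int (card (?I \<inter> {- lo..k div 2 + 1}))"
      using sum.inter_restrict[of ?I "\<lambda>_. 1 :: int" "{- lo..k div 2 + 1}"] by simp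
    also have "\<dots> \<le> int (card {- lo..k div 2 + 1})"
      unfolding of_nat_le_iff by (intro card_mono) auto
    also have "\<dots> = lo + k div 2 + 2" using assms(1) by (simp add: lo_def)
    finally have "(\<Sum>j\<in>?I. if j \<in> {- lo..k div 2 + 1} then 1 else (0 :: int)) \<le> lo + k div 2 + 2" .
    moreover have "(\<Sum>j\<in>?I. if even k \<and> j = - (k div 2) then 1 else (0 :: int)) \<le> (if even k then 1 else 0)"
      by (cases "even k") simp_all
    ultimately show ?thesis unfolding sum.distrib by linarith
  qed
  moreover have "lo + k div 2 + 2 + (if even k then 1 else 0) = 2 * (k div 2) + (if k = 2 then 5 else 3)"
    by (auto simp: lo_def elim!: evenE oddE)
  moreover have "(\<Sum>j\<in>?I. sgn (a j - f (j - 1) - 1)) = (\<Sum>j\<in>{0..<n}. sgn (a j - f (j - 1) - 1))"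
    by (rule sum_residues[OF n_pos]) (simp add: outer_norm_cong circ_norm_cong[OF shift])
  moreover have "(\<Sum>j\<in>?I. sgn (f j - f (j - 1) + 1)) = (\<Sum>j\<in>{0..<n}. sgn (f j - f (j - 1) + 1))"
    by (rule sum_residues[OF n_pos]) (simp add: circ_norm_cong circ_norm_cong[OF shift])
  ultimately show ?thesis unfolding sum_subtractf by linarith
qed

text \<open>The generic signs of the outer and inner vertices cancel in total, leaving the
  \<open>2 * T\<close> inner gains against the outer losses.\<close>

lemma spoke_balance_ge:
  assumes "2 \<le> k" "k * k + 1 < 2 * n" "(2 * T - 1) * k < n"
  shows "2 * T - (2 * (k div 2) + (if k = 2 then 5 else 3)) \<le> spoke_balance n k 1"
proof -
  have "(\<Sum>j\<in>{0..<n}. f (j - 1)) = (\<Sum>j\<in>{-1..<-1 + n}. f j)"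
    by (rule sum.reindex_bij_witness[of _ "\<lambda>j. j + 1" "\<lambda>j. j - 1"]) auto
  also have "\<dots> = (\<Sum>j\<in>{0..<n}. f j)" by (rule sum_residues[OF n_pos circ_norm_cong])
  finally have "(\<Sum>j\<in>{0..<n}. f j - f (j - 1)) = 0" by (simp add: sum_subtractf)
  \<comment> \<open>For \<bar>d\<bar> \<le> 1 the signs of \<open>d + 1\<close> and
    \<open>d - 1\<close> add up to \<open>d\<close>, which turns the generic signs into a
    telescoping sum.\<close>
  moreover have "sgn (f j - f (j - 1) + 1) + sgn (f j - f (j - 1) - 1) = f j - f (j - 1)" for j
    using circ_norm_diff_le[of j] by (auto simp: sgn_if)
  ultimately have "(\<Sum>j\<in>{0..<n}. sgn (f j - f (j - 1) + 1)) + (\<Sum>j\<in>{0..<n}. sgn (f j - f (j - 1) - 1)) = 0"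
    by (simp flip: sum.distrib)
  then show ?thesis
    using inner_gain[of T] outer_loss assms unfolding spoke_balance_def sum.distrib by linarith
qed

end

section \<open>Evaluation of the small graphs\<close>

text \<open>Naming the summands keeps the simplifier from unfolding them under a binder, which makes
  evaluation by rewriting feasible.\<close>

definition circ_cost :: "int \<Rightarrow> int \<Rightarrow> int \<Rightarrow> int \<Rightarrow> int" where
  "circ_cost n k x t = cyc_norm n t + cyc_norm n (x - t * k)"

definition inner_cost :: "int \<Rightarrow> int \<Rightarrow> int \<Rightarrow> int \<Rightarrow> int" where
  "inner_cost n k x t = cyc_norm n t + (if n dvd x - t * k then 0 else cyc_norm n (x - t * k) + 2)"

definition spoke_term :: "int \<Rightarrow> int \<Rightarrow> int \<Rightarrow> int \<Rightarrow> int" where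
  "spoke_term n k d j = sgn (outer_norm n k j - circ_norm n k (j - d) - 1) +
     sgn (circ_norm n k j + 1 - inner_norm n k (j - d))"

lemma eval_code [code]:
  "circ_norm n k x = Min (circ_cost n k x ` {0..<n})"
  "inner_norm n k x = Min (inner_cost n k x ` {0..<n})"
  "spoke_balance n k d = sum (spoke_term n k d) {0..<n}"
  by (simp_all add: circ_norm_def circ_cost_def[abs_def] inner_norm_def inner_cost_def[abs_def]
      spoke_balance_def spoke_term_def)

text \<open>These values cover the range the estimate is not applied to: up to 14 for
  \<open>k = 2\<close>, 15 for \<open>k = 3\<close> and 28 for \<open>k = 4\<close>. At the upper
  ends for \<open>k = 3\<close> and \<open>k = 4\<close> the difference \<open>k\<close> serves as
  witness.\<close>

lemma spoke_balance_nonzero_eval: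
  "spoke_balance 11 2 1 \<noteq> 0" "spoke_balance 12 2 1 \<noteq> 0"
  "spoke_balance 13 2 1 \<noteq> 0" "spoke_balance 14 2 1 \<noteq> 0"
  "spoke_balance 11 3 1 \<noteq> 0" "spoke_balance 12 3 1 \<noteq> 0" "spoke_balance 13 3 1 \<noteq> 0"
  "spoke_balance 14 3 1 \<noteq> 0" "spoke_balance 15 3 3 \<noteq> 0"
  "spoke_balance 22 4 1 \<noteq> 0" "spoke_balance 23 4 1 \<noteq> 0" "spoke_balance 24 4 1 \<noteq> 0"
  "spoke_balance 25 4 1 \<noteq> 0" "spoke_balance 26 4 1 \<noteq> 0" "spoke_balance 27 4 1 \<noteq> 0"
  "spoke_balance 28 4 4 \<noteq> 0"
  by code_simp+

lemma spoke_balance_zero_eval: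
  "spoke_balance 10 2 1 = 0" "spoke_balance 10 2 2 = 0"
  "spoke_balance 10 3 1 = 0" "spoke_balance 10 3 3 = 0"
  "spoke_balance 21 4 1 = 0" "spoke_balance 21 4 4 = 0"
  by code_simp+

section \<open>Large \<open>n\<close> and the final case distinction\<close>

lemma not_distance_balanced_GP_large:
  assumes k: "3 \<le> k" and n: "k * (2 * (k div 2) + 3) < n"
  shows "\<not> distance_balanced 2 (GP n k)"
proof -
  have "k * 2 \<le> k * (2 * (k div 2) + 3)" "k * (k + 2) \<le> k * (2 * (k div 2) + 3)"
    by (intro mult_le_mono2; presburger)+
  then have kn: "2 * k < n" "k * k + 1 < 2 * n" using n k by (simp_all add: algebra_simps)
  interpret circulant "int n" "int k" by unfold_locales (use kn in simp)
  \<comment> \<open>The least \<open>T\<close> for which \<open>2 * T\<close> exceeds the loss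
    \<open>2 * (k div 2) + 3\<close>.\<close>
  let ?T = "int k div 2 + 2"
  have "(2 * ?T - 1) * int k = int (k * (2 * (k div 2) + 3))"
    by (simp add: zdiv_int algebra_simps)
  also have "\<dots> < int n" using n by (simp only: of_nat_less_iff)
  finally have "(2 * ?T - 1) * int k < int n" .
  moreover have "int k * int k + 1 < 2 * int n"
    using kn(2) by (simp flip: of_nat_mult)
  ultimately have "0 < spoke_balance (int n) (int k) 1"
    using spoke_balance_ge[of ?T] k by simp
  then show ?thesis using k kn by (simp add: distance_balanced_GP_iff_spoke_balance)
qed

lemma not_distance_balanced_GP_2:
  assumes "10 < n"
  shows "\<not> distance_balanced 2 (GP n 2)"
proof -
  interpret circulant "int n" 2 by unfold_locales (use assms in simp)
  have "n = 11 \<or> n = 12 \<or> n = 13 \<or> n = 14 \<or> 15 \<le> n" using assms by linarith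
  then have "spoke_balance (int n) 2 1 \<noteq> 0"
    \<comment> \<open>With \<open>T = 4\<close> the gain 8 exceeds the loss 7, and the condition on
      \<open>n\<close> becomes \<open>14 < n\<close>.\<close>
    using spoke_balance_nonzero_eval(1-4) spoke_balance_ge[of 4] by auto
  then show ?thesis using assms distance_balanced_GP_iff_spoke_balance[of 2 n] by simp
qed

lemma not_distance_balanced_GP_3:
  assumes "10 < n"
  shows "\<not> distance_balanced 2 (GP n 3)"
proof (cases "15 < n")
  case False
  then have "n = 11 \<or> n = 12 \<or> n = 13 \<or> n = 14 \<or> n = 15" using assms by linarith
  then show ?thesis
    using spoke_balance_nonzero_eval(5-9) distance_balanced_GP_iff_spoke_balance[of 3 n] by auto
qed (simp add: not_distance_balanced_GP_large)

lemma not_distance_balanced_GP_4: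
  assumes "21 < n"
  shows "\<not> distance_balanced 2 (GP n 4)"
proof (cases "28 < n")
  case False
  then have "n = 22 \<or> n = 23 \<or> n = 24 \<or> n = 25 \<or> n = 26 \<or> n = 27 \<or> n = 28"
    using assms by linarith
  then show ?thesis
    using spoke_balance_nonzero_eval(10-16) distance_balanced_GP_iff_spoke_balance[of 4 n] by auto
qed (simp add: not_distance_balanced_GP_large)

theorem theorem1p5:
  shows
    "(\<forall>n k :: nat. 2 \<le> k \<and> real k < real n / 2 \<longrightarrow>
        (6 \<le> k \<and> even k \<and> real n > 5 / 4 * real k ^ 2 + 2 * real k
           \<longrightarrow> \<not> distance_balanced 2 (GP n k)) \<and>
        (5 \<le> k \<and> odd k \<and> real n > 7 / 4 * real k ^ 2 + 3 / 4 * real k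
           \<longrightarrow> \<not> distance_balanced 2 (GP n k)) \<and>
        (k = 2 \<and> n > 10 \<or> k = 3 \<and> n > 10 \<or> k = 4 \<and> n > 21
           \<longrightarrow> \<not> distance_balanced 2 (GP n k))) \<and>
     distance_balanced 2 (GP 10 2) \<and>
     distance_balanced 2 (GP 10 3) \<and>
     distance_balanced 2 (GP 21 4)"
proof (intro conjI allI impI; (elim conjE)?)
  fix n k :: nat
  assume k: "6 \<le> k" "even k" and n: "real n > 5 / 4 * real k ^ 2 + 2 * real k"
  \<comment> \<open>This is the inequality that places \<open>k * (k + 3)\<close> below the stated
    bound.\<close>
  have "real k * 4 \<le> real k * real k" using k by (intro mult_left_mono) auto
  then have "real (k * (k + 3)) < real n" using n by (simp add: power2_eq_square algebra_simps)
  then have "k * (k + 3) < n" by (simp only: of_nat_less_iff)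
  then have "k * (2 * (k div 2) + 3) < n" using k by simp
  then show "\<not> distance_balanced 2 (GP n k)" using k by (intro not_distance_balanced_GP_large) auto
next
  fix n k :: nat
  assume k: "5 \<le> k" "odd k" and n: "real n > 7 / 4 * real k ^ 2 + 3 / 4 * real k"
  have "real k * 5 \<le> real k * real k" using k by (intro mult_left_mono) auto
  then have "real (k * (k + 2)) < real n" using n by (simp add: power2_eq_square algebra_simps)
  then have "k * (k + 2) < n" by (simp only: of_nat_less_iff)
  moreover have "2 * (k div 2) + 3 = k + 2" using k by presburger
  ultimately have "k * (2 * (k div 2) + 3) < n" by (simp only:)
  then show "\<not> distance_balanced 2 (GP n k)" using k by (intro not_distance_balanced_GP_large) auto
next
  fix n k :: nat
  assume "k = 2 \<and> n > 10 \<or> k = 3 \<and> n > 10 \<or> k = 4 \<and> n > 21"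
  then show "\<not> distance_balanced 2 (GP n k)"
    using not_distance_balanced_GP_2 not_distance_balanced_GP_3 not_distance_balanced_GP_4 by blast
qed (simp_all add: distance_balanced_GP_iff_spoke_balance spoke_balance_zero_eval)

end
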